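(* Let $D \subseteq \mathbb{R}^{n+1}$ be a domain, where $\mathbb{R}^{n+1} = \mathbb{R} \oplus \mathbb{R}^n \subset Cl_n$ is the space of paravectors, and let $f : D \to \mathbb{R}^{n+1} \subset Cl_n$ be a paravector-valued $C^1(D)$-function satisfying $\frac{\partial f}{\partial x_0}(z) \neq 0$ at all $z \in D$. Then $f$ is conformal in the sense of Gauss if and only if there exist $n$ continuous functions $\Psi_1,\ldots,\Psi_n$ on $D$ with values in $Cl_n$, each taking values in $\mathbb{R}^n \oplus \mathbb{R}^{n,n}$ and in the spin group $\mathrm{Spin}(n+1)$, such that at each $z \in D$: (i)' $\mathrm{Sc}(\Psi_i(z)) = 0$ for $i = 1,\ldots,n$; (ii)' $\mathrm{Sc}\{\Psi_i(z)\, \overline{\Psi_j(z)}\} = \delta_{ij}$ for all $i,j \in \{1,\ldots,n\}$; and $$\frac{\partial f}{\partial x_k}(z) = \Psi_k(z)\, \frac{\partial f}{\partial x_0}(z), \qquad k = 1,\ldots,n,$$ where the product on the right-hand side is the product in $Cl_n$.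
   Context: Here $n \geq 1$, and $Cl_n$ is the real associative Clifford algebra generated by the standard orthonormal basis $e_1,\ldots,e_n$ of $\mathbb{R}^n$, with unit $e_0=1$ and relations $e_i^2 = -1$, $e_i e_j = -e_j e_i$ for $i \neq j$. It has the real basis $e_A = e_{l_1} \cdots e_{l_r}$, $A = \{l_1 < \cdots < l_r\} \subseteq \{1,\ldots,n\}$, $e_\emptyset = 1$. For $a = \sum_A a_A e_A$, the scalar part is $\mathrm{Sc}(a) = a_\emptyset = a_0$. Conjugation is the real-linear anti-automorphism with $\overline{e_j} = -e_j$ for $j=1,\ldots,n$ and $\overline{ab} = \overline{b}\,\overline{a}$. The paravector space $\mathbb{R} \oplus \mathbb{R}^n$ consists of the elements $z = x_0 + x_1 e_1 + \cdots + x_n e_n$ with $x_i \in \mathbb{R}$; it is identified with $\mathbb{R}^{n+1}$ and carries the Euclidean norm $|z| = \sqrt{\sum_{i=0}^n x_i^2}$. $\mathbb{R}^{n,n}$ denotes the space of bivectors, i.e. the real span of the $e_i e_j$ with $1 \le i < j \le n$, and $\mathbb{R}^n$ the space of vectors, i.e. the real span of $e_1,\ldots,e_n$; so $\mathbb{R}^n \oplus \mathbb{R}^{n,n}$ is the set of elements of $Cl_n$ having only a vector part and a bivector part. The spin group is $$\mathrm{Spin}(n+1) = \Big\{ \prod_{i=1}^{2k} a_i \;\Big|\; k \in \mathbb{N},\ a_i \in \mathbb{R}^{n+1} = \mathbb{R}\oplus\mathbb{R}^n,\ |a_i| = 1 \Big\} \subset Cl_n.$$ $\delta_{ij}$ is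 the Kronecker symbol. A domain is a nonempty connected open set. A $C^1(D)$-function is one whose real component functions are continuously differentiable on $D$; the partial derivatives $\frac{\partial f}{\partial x_i}$ ($i=0,\ldots,n$) are paravector-valued. A paravector-valued $C^1(D)$-function $f$ is called conformal in the sense of Gauss if there is a function $\lambda : D \to \mathbb{R}^{>0}$ with $|df|^2 = \lambda(z)|dz|^2$ on $D$, where $df = \sum_{i=0}^n \frac{\partial f}{\partial x_i} dx_i$ and $dz = dx_0 + \sum_{i=1}^n e_i\,dx_i$; that is, $\left| \sum_{i=0}^n v_i \frac{\partial f}{\partial x_i}(z) \right|^2 = \lambda(z) \sum_{i=0}^n v_i^2$ for all $z \in D$ and all $(v_0,\ldots,v_n) \in \mathbb{R}^{n+1}$. *)

theory Defs
  imports "HOL-Analysis.Analysis"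
begin

text \<open>
  The Clifford algebra \<open>Cl\<^sub>n\<close> is the type \<open>'n clifford\<close>, where the finite linearly ordered type
  \<open>'n\<close> plays the role of \<open>{1,\<dots>,n}\<close> (so \<open>n = CARD('n) \<ge> 1\<close>).  An element is given by its
  coefficients with respect to the basis \<open>e\<^sub>A\<close>, \<open>A \<subseteq> {1,\<dots>,n}\<close>.  The type is a copy of
  \<open>real ^ 'n set\<close> because the latter already carries the componentwise product.
\<close>

typedef (overloaded) ('n::"{finite,linorder}") clifford = "UNIV :: (real ^ 'n set) set"
  morphisms cl_coeffs of_cl_coeffs
  by simp

definition cl_coeff :: "'n::{finite,linorder} clifford \<Rightarrow> 'n set \<Rightarrow> real"
  where "cl_coeff a A = cl_coeffs a $ A"

definition blade :: "'n::{finite,linorder} set \<Rightarrow> 'n clifford"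
  where "blade A = of_cl_coeffs (axis A 1)"

definition cl_e :: "'n::{finite,linorder} \<Rightarrow> 'n clifford"
  where "cl_e i = blade {i}"

text \<open>
  \<open>e\<^sub>A e\<^sub>B = \<plusminus> e\<^bsub>A \<triangle> B\<^esub>\<close>: sorting the factors costs a sign for every pair \<open>a \<in> A\<close>, \<open>b \<in> B\<close> with
  \<open>b < a\<close> (anticommutation), and every common index contributes \<open>e\<^sub>i\<^sup>2 = -1\<close>.
\<close>
definition blade_sign :: "'n::{finite,linorder} set \<Rightarrow> 'n set \<Rightarrow> real"
  where "blade_sign A B = (-1) ^ card {(a, b). a \<in> A \<and> b \<in> B \<and> b \<le> a}"

lemma cl_coeff_of_cl_coeffs [simp]: "cl_coeff (of_cl_coeffs x) A = x $ A"
  by (simp add: cl_coeff_def of_cl_coeffs_inverse)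

lemma clifford_eqI: "(\<And>A. cl_coeff a A = cl_coeff b A) \<Longrightarrow> a = b"
  by (metis cl_coeff_def cl_coeffs_inverse vec_eq_iff)

subsection \<open>Algebra structure\<close>

instantiation clifford :: ("{finite,linorder}") "{zero,one,plus,minus,uminus,times,scaleR}"
begin

definition "0 = of_cl_coeffs 0"
definition "1 = blade {}"
definition "a + b = of_cl_coeffs (cl_coeffs a + cl_coeffs b)"
definition "a - b = of_cl_coeffs (cl_coeffs a - cl_coeffs b)"
definition "- a = of_cl_coeffs (- cl_coeffs a)"
definition "r *\<^sub>R a = of_cl_coeffs (r *\<^sub>R cl_coeffs a)"
definition "a * b = of_cl_coeffs (\<chi> C. \<Sum>A\<in>UNIV. \<Sum>B\<in>UNIV.
  if sym_diff A B = C then blade_sign A B * cl_coeff a A * cl_coeff b B else 0)"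

instance ..

end

lemma cl_coeff_zero [simp]: "cl_coeff 0 A = 0"
  by (simp add: zero_clifford_def)

lemma cl_coeff_blade: "cl_coeff (blade B) A = (if A = B then 1 else 0)"
  by (simp add: blade_def axis_def)

lemma blade_eq_iff [simp]: "blade A = blade B \<longleftrightarrow> A = B"
proof
  assume "blade A = blade B"
  then have "cl_coeff (blade A) A = cl_coeff (blade B) A" by (rule arg_cong)
  then show "A = B" by (simp add: cl_coeff_blade split: if_splits)
qed simp

lemma cl_coeff_one: "cl_coeff 1 A = (if A = {} then 1 else 0)"
  by (simp add: one_clifford_def cl_coeff_blade)

lemma cl_coeff_add [simp]: "cl_coeff (a + b) A = cl_coeff a A + cl_coeff b A"
  unfolding plus_clifford_def by (simp add: cl_coeff_def of_cl_coeffs_inverse)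

lemma cl_coeff_diff [simp]: "cl_coeff (a - b) A = cl_coeff a A - cl_coeff b A"
  unfolding minus_clifford_def by (simp add: cl_coeff_def of_cl_coeffs_inverse)

lemma cl_coeff_uminus [simp]: "cl_coeff (- a) A = - cl_coeff a A"
  unfolding uminus_clifford_def by (simp add: cl_coeff_def of_cl_coeffs_inverse)

lemma cl_coeff_scaleR [simp]: "cl_coeff (r *\<^sub>R a) A = r * cl_coeff a A"
  unfolding scaleR_clifford_def by (simp add: cl_coeff_def of_cl_coeffs_inverse)

lemma sym_diff_eq_iff: "sym_diff A B = C \<longleftrightarrow> B = sym_diff A C"
  by auto

lemma cl_coeff_mult:
  "cl_coeff (a * b) C =
    (\<Sum>A\<in>UNIV. blade_sign A (sym_diff A C) * cl_coeff a A * cl_coeff b (sym_diff A C))"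
  unfolding times_clifford_def sym_diff_eq_iff by simp

lemma blade_sign_prod:
  "blade_sign A B = (\<Prod>a\<in>A. \<Prod>b\<in>B. if b \<le> a then -1 else 1)"
proof -
  have "(\<Prod>a\<in>A. \<Prod>b\<in>B. if b \<le> a then -1 else (1::real))
      = (\<Prod>p\<in>A \<times> B. if snd p \<le> fst p then -1 else 1)"
    by (simp add: prod.cartesian_product case_prod_beta)
  also have "\<dots> = (\<Prod>p\<in>{p \<in> A \<times> B. snd p \<le> fst p}. -1)"
    by (rule prod.inter_filter [symmetric]) simp
  also have "{p \<in> A \<times> B. snd p \<le> fst p} = {(a, b). a \<in> A \<and> b \<in> B \<and> b \<le> a}"
    by auto
  finally show ?thesis
    by (simp add: blade_sign_def)
qed

lemma prod_sym_diff:
  fixes g :: "'a::finite \<Rightarrow> real"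
  assumes "\<And>x. g x * g x = 1"
  shows "prod g (sym_diff A B) = prod g A * prod g B"
proof -
  have "prod g A = prod g (A - B) * prod g (A \<inter> B)"
    by (metis finite_code prod.Int_Diff mult.commute)
  moreover have "prod g B = prod g (B - A) * prod g (A \<inter> B)"
    by (metis finite_code prod.Int_Diff mult.commute Int_commute)
  moreover have "prod g (sym_diff A B) = prod g (A - B) * prod g (B - A)"
    by (rule prod.union_disjoint) auto
  moreover have "prod g (A \<inter> B) * prod g (A \<inter> B) = 1"
    by (simp add: assms flip: prod.distrib)
  ultimately show ?thesis
    by (metis (no_types, lifting) mult.assoc mult.commute mult.right_neutral)
qed

lemma blade_sign_square [simp]: "blade_sign A B * blade_sign A B = 1"
  by (simp add: blade_sign_def flip: power_add mult_2)

lemma blade_sign_left: "blade_sign (sym_diff A B) C = blade_sign A C * blade_sign B C"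
  unfolding blade_sign_prod by (rule prod_sym_diff) (unfold prod.distrib [symmetric], rule prod.neutral, simp)

lemma blade_sign_right: "blade_sign C (sym_diff A B) = blade_sign C A * blade_sign C B"
  unfolding blade_sign_prod
  by (subst prod_sym_diff) (auto simp flip: prod.distrib)

lemma blade_sign_empty [simp]: "blade_sign {} A = 1" "blade_sign A {} = 1"
  by (simp_all add: blade_sign_def)

lemma clifford_mult_assoc: "(a * b) * c = a * (b * c)" for a b c :: "'n::{finite,linorder} clifford"
proof (rule clifford_eqI)
  fix D :: "'n set"
  let ?s = "blade_sign :: 'n set \<Rightarrow> 'n set \<Rightarrow> real"
  have sgn: "?s E (sym_diff E D) * ?s A (sym_diff A E)
      = ?s A (sym_diff A D) * ?s (sym_diff A E) (sym_diff E D)" for A E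
    using blade_sign_square[of A D]
    unfolding blade_sign_left blade_sign_right by algebra
  have *: "sym_diff (sym_diff A E) (sym_diff A D) = sym_diff E D"
      "sym_diff A (sym_diff A E) = E" for A E :: "'n set"
    by auto
  have "cl_coeff ((a * b) * c) D = (\<Sum>E\<in>UNIV. \<Sum>A\<in>UNIV.
      ?s E (sym_diff E D) * ?s A (sym_diff A E) *
      (cl_coeff a A * cl_coeff b (sym_diff A E) * cl_coeff c (sym_diff E D)))"
    unfolding cl_coeff_mult
    by (simp add: sum_distrib_left sum_distrib_right mult_ac)
  also have "\<dots> = (\<Sum>A\<in>UNIV. \<Sum>E\<in>UNIV.
      ?s A (sym_diff A D) * ?s (sym_diff A E) (sym_diff E D) *
      (cl_coeff a A * cl_coeff b (sym_diff A E) * cl_coeff c (sym_diff E D)))"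
    unfolding sgn by (rule sum.swap)
  also have "\<dots> = (\<Sum>A\<in>UNIV. \<Sum>B\<in>UNIV.
      ?s A (sym_diff A D) * ?s B (sym_diff B (sym_diff A D)) *
      (cl_coeff a A * cl_coeff b B * cl_coeff c (sym_diff B (sym_diff A D))))"
  proof (rule sum.cong [OF refl])
    fix A :: "'n set"
    show "(\<Sum>E\<in>UNIV. ?s A (sym_diff A D) * ?s (sym_diff A E) (sym_diff E D) *
        (cl_coeff a A * cl_coeff b (sym_diff A E) * cl_coeff c (sym_diff E D)))
      = (\<Sum>B\<in>UNIV. ?s A (sym_diff A D) * ?s B (sym_diff B (sym_diff A D)) *
        (cl_coeff a A * cl_coeff b B * cl_coeff c (sym_diff B (sym_diff A D))))"
      by (rule sum.reindex_bij_witness[where i = "sym_diff A" and j = "sym_diff A"])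
         (simp_all only: * UNIV_I)
  qed
  also have "\<dots> = cl_coeff (a * (b * c)) D"
    unfolding cl_coeff_mult
    by (simp add: sum_distrib_left sum_distrib_right mult_ac)
  finally show "cl_coeff ((a * b) * c) D = cl_coeff (a * (b * c)) D" .
qed

instance clifford :: ("{finite,linorder}") real_algebra_1
proof
  fix a b c :: "'a clifford" and r s :: real
  show "a * b * c = a * (b * c)"
    by (rule clifford_mult_assoc)
  show "1 * a = a"
    by (rule clifford_eqI) (simp add: cl_coeff_mult cl_coeff_one if_distrib if_distribR cong: if_cong)
  show "a * 1 = a"
  proof (rule clifford_eqI)
    fix C :: "'a set"
    have empty: "sym_diff A C = {} \<longleftrightarrow> A = C" for A :: "'a set"
      by auto
    have "cl_coeff (a * 1) C = (\<Sum>A\<in>UNIV. if A = C then cl_coeff a A else 0)"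
      unfolding cl_coeff_mult cl_coeff_one empty by (rule sum.cong) auto
    then show "cl_coeff (a * 1) C = cl_coeff a C"
      by simp
  qed
  show "(0::'a clifford) \<noteq> 1"
    by (metis cl_coeff_one cl_coeff_zero zero_neq_one)
  show "(a + b) * c = a * c + b * c" "a * (b + c) = a * b + a * c"
    by (rule clifford_eqI, simp add: cl_coeff_mult distrib_left distrib_right sum.distrib)+
  show "(r *\<^sub>R a) * b = r *\<^sub>R (a * b)" "a * (r *\<^sub>R b) = r *\<^sub>R (a * b)"
    by (rule clifford_eqI, simp add: cl_coeff_mult sum_distrib_left mult_ac)+
qed (rule clifford_eqI; simp add: algebra_simps)+

lemma blade_mult: "blade A * blade B = blade_sign A B *\<^sub>R blade (sym_diff A B)"
proof (rule clifford_eqI)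
  fix C
  have "cl_coeff (blade A * blade B) C
      = blade_sign A (sym_diff A C) * cl_coeff (blade B) (sym_diff A C)"
    by (simp add: cl_coeff_mult cl_coeff_blade[of A] if_distrib if_distribR cong: if_cong)
  also have "\<dots> = blade_sign A B * cl_coeff (blade B) (sym_diff A C)"
    by (cases "sym_diff A C = B") (simp_all only: cl_coeff_blade if_False mult_zero_right)
  also have "cl_coeff (blade B) (sym_diff A C) = cl_coeff (blade (sym_diff A B)) C"
    unfolding cl_coeff_blade by (rule if_cong) auto
  finally show "cl_coeff (blade A * blade B) C = cl_coeff (blade_sign A B *\<^sub>R blade (sym_diff A B)) C"
    by (simp only: cl_coeff_scaleR)
qed

lemma cl_e_square: "cl_e i * cl_e i = - 1"
proof -
  have "{(a, b). a \<in> {i} \<and> b \<in> {i} \<and> b \<le> a} = {(i, i)}" by auto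
  then show ?thesis
    by (simp add: cl_e_def blade_mult blade_sign_def one_clifford_def)
qed

lemma cl_e_anticommute:
  assumes "i \<noteq> j" shows "cl_e i * cl_e j = - (cl_e j * cl_e i)"
proof -
  have "sym_diff {i} {j} = sym_diff {j} {i}" by auto
  moreover have "blade_sign {i} {j} = - blade_sign {j} {i}"
    using assms by (auto simp: blade_sign_prod)
  ultimately show ?thesis
    by (simp add: cl_e_def blade_mult)
qed

lemma blade_eq_prod_list: "blade A = prod_list (map cl_e (sorted_list_of_set A))"
  using finite[of A]
proof (induction A rule: finite_linorder_min_induct)
  case empty
  then show ?case by (simp add: one_clifford_def)
next
  case (insert x A)
  have "blade_sign {x} A = 1"
    unfolding blade_sign_prod using insert by (force intro: prod.neutral)
  moreover have "sym_diff {x} A = insert x A"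
    using insert by auto
  ultimately have "blade (insert x A) = cl_e x * blade A"
    by (simp add: cl_e_def blade_mult)
  moreover have "sorted_list_of_set (insert x A) = x # sorted_list_of_set A"
    using insert by (subst sorted_list_of_set_insert) (auto simp: insort_is_Cons less_imp_le)
  ultimately show ?case
    using insert by simp
qed

lemma clifford_expansion: "a = (\<Sum>A\<in>UNIV. cl_coeff a A *\<^sub>R blade A)"
proof (rule clifford_eqI)
  fix B
  have "cl_coeff (sum h S) B = (\<Sum>A\<in>S. cl_coeff (h A) B)"
    for h :: "'a set \<Rightarrow> 'a clifford" and S
    by (induction S rule: infinite_finite_induct) auto
  then show "cl_coeff a B = cl_coeff (\<Sum>A\<in>UNIV. cl_coeff a A *\<^sub>R blade A) B"
    by (simp add: cl_coeff_blade if_distrib if_distribR cong: if_cong)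
qed

subsection \<open>Euclidean structure\<close>

text \<open>The norm is the Euclidean norm of the coefficient vector; on paravectors it is \<open>|z|\<close>.\<close>

instantiation clifford :: ("{finite,linorder}") euclidean_space
begin

definition "inner a b = inner (cl_coeffs a) (cl_coeffs b)"
definition "norm a = norm (cl_coeffs a)"
definition "dist a b = norm (a - b)" for a b :: "'a clifford"
definition "sgn a = inverse (norm a) *\<^sub>R a" for a :: "'a clifford"
definition "(uniformity :: ('a clifford \<times> 'a clifford) filter)
  = (INF e\<in>{0 <..}. principal {(x, y). dist x y < e})"
definition "open U \<longleftrightarrow>
  (\<forall>x\<in>U. eventually (\<lambda>(x', y). x' = x \<longrightarrow> y \<in> U) uniformity)" for U :: "'a clifford set"
definition "Basis = range (blade :: 'a set \<Rightarrow> 'a clifford)"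

instance
proof
  fix a b c :: "'a clifford" and r :: real and u v :: "'a clifford"
  have cl_coeffs [simp]: "cl_coeffs (a + b) = cl_coeffs a + cl_coeffs b" "cl_coeffs (r *\<^sub>R a) = r *\<^sub>R cl_coeffs a"
    for a b :: "'a clifford" and r
    by (simp_all add: plus_clifford_def scaleR_clifford_def of_cl_coeffs_inverse)
  have coeffs0: "cl_coeffs a = 0 \<longleftrightarrow> a = 0" for a :: "'a clifford"
    by (metis cl_coeffs_inverse of_cl_coeffs_inverse UNIV_I zero_clifford_def)
  have cblade: "cl_coeffs (blade A) = axis A 1" for A :: "'a set"
    by (simp add: blade_def of_cl_coeffs_inverse)
  show "inner a b = inner b a"
    by (simp add: inner_clifford_def inner_commute)
  show "inner (a + b) c = inner a c + inner b c"
    by (simp add: inner_clifford_def inner_add_left)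
  show "inner (r *\<^sub>R a) b = r * inner a b"
    by (simp add: inner_clifford_def)
  show "0 \<le> inner a a"
    by (simp add: inner_clifford_def)
  show "inner a a = 0 \<longleftrightarrow> a = 0"
    by (simp add: inner_clifford_def coeffs0)
  show "norm a = sqrt (inner a a)"
    by (simp add: inner_clifford_def norm_clifford_def norm_eq_sqrt_inner)
  show "finite (Basis :: 'a clifford set)" "(Basis :: 'a clifford set) \<noteq> {}"
    by (simp_all add: Basis_clifford_def)
  show "inner u v = (if u = v then 1 else 0)" if "u \<in> Basis" "v \<in> Basis"
    using that by (auto simp: Basis_clifford_def inner_clifford_def cblade inner_axis_axis)
  show "(\<forall>u\<in>Basis. inner a u = 0) \<longleftrightarrow> a = 0"
    unfolding Basis_clifford_def
    by (simp add: inner_clifford_def cblade inner_axis vec_eq_iff flip: coeffs0)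
qed (simp_all add: dist_clifford_def sgn_clifford_def uniformity_clifford_def open_clifford_def)

end

lemma norm_clifford_eq: "norm a = sqrt (\<Sum>A\<in>UNIV. (cl_coeff a A)\<^sup>2)"
  by (simp add: norm_clifford_def norm_vec_def L2_set_def cl_coeff_def)

subsection \<open>Scalar part, conjugation, distinguished subspaces and the spin group\<close>

definition Sc :: "'n::{finite,linorder} clifford \<Rightarrow> real"
  where "Sc a = cl_coeff a {}"

text \<open>
  On a product of \<open>r\<close> distinct generators, conjugation reverses the order (\<open>r (r - 1) / 2\<close>
  transpositions) and changes \<open>r\<close> signs.
\<close>
definition cl_conj :: "'n::{finite,linorder} clifford \<Rightarrow> 'n clifford"
  where "cl_conj a =
    of_cl_coeffs (\<chi> A. (-1) ^ (card A * (card A + 1) div 2) * cl_coeff a A)"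

lemma cl_conj_sign: "(-1) ^ (card A * (card A + 1) div 2) = blade_sign A A"
proof -
  have "card {(a, b). a \<in> A \<and> b \<in> A \<and> b \<le> a} = card A * (card A + 1) div 2"
    using finite[of A]
  proof (induction A rule: finite_linorder_max_induct)
    case (insert x A)
    have "{(a, b). a \<in> insert x A \<and> b \<in> insert x A \<and> b \<le> a} =
        {(a, b). a \<in> A \<and> b \<in> A \<and> b \<le> a} \<union> Pair x ` insert x A"
      using insert by (auto simp: less_imp_le dest: leD)
    moreover have "card ({(a, b). a \<in> A \<and> b \<in> A \<and> b \<le> a} \<union> Pair x ` insert x A)
        = card {(a, b). a \<in> A \<and> b \<in> A \<and> b \<le> a} + card (Pair x ` insert x A)"
      using insert by (intro card_Un_disjoint) auto
    moreover have "card (Pair x ` insert x A) = card (insert x A)"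
      by (rule card_image) (simp add: inj_on_def)
    moreover have "card (insert x A) = Suc (card A)"
      using insert by (intro card_insert_disjoint) auto
    moreover have "card A * (card A + 1) div 2 + Suc (card A) = Suc (card A) * (Suc (card A) + 1) div 2"
      by simp
    ultimately show ?case
      using insert.IH by (simp only:)
  qed simp_all
  then show ?thesis
    by (simp add: blade_sign_def)
qed

lemma cl_coeff_conj: "cl_coeff (cl_conj a) A = blade_sign A A * cl_coeff a A"
  by (simp add: cl_conj_def flip: cl_conj_sign)

lemma linear_cl_conj: "linear cl_conj"
  by (rule linearI; rule clifford_eqI; simp add: cl_coeff_conj algebra_simps)

lemma cl_conj_e: "cl_conj (cl_e j) = - cl_e j"
  by (rule clifford_eqI) (simp add: cl_coeff_conj cl_e_def cl_coeff_blade blade_sign_prod)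

lemma cl_conj_mult: "cl_conj (a * b) = cl_conj b * cl_conj a"
proof (rule clifford_eqI)
  fix C :: "'a set"
  let ?s = "blade_sign :: 'a set \<Rightarrow> 'a set \<Rightarrow> real"
  have sgn: "?s C C * ?s A (sym_diff A C)
      = ?s (sym_diff A C) A * ?s (sym_diff A C) (sym_diff A C) * ?s A A" for A
    using blade_sign_square[of A A] blade_sign_square[of C A]
    unfolding blade_sign_left blade_sign_right by algebra
  have 1: "sym_diff (sym_diff A C) C = A" for A by auto
  have "cl_coeff (cl_conj (a * b)) C = (\<Sum>A\<in>UNIV. (?s C C * ?s A (sym_diff A C)) *
      (cl_coeff a A * cl_coeff b (sym_diff A C)))"
    by (simp add: cl_coeff_conj cl_coeff_mult sum_distrib_left mult_ac)
  also have "\<dots> = (\<Sum>A\<in>UNIV. ?s (sym_diff A C) A * ?s (sym_diff A C) (sym_diff A C) * ?s A A *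
      (cl_coeff a A * cl_coeff b (sym_diff A C)))"
    unfolding sgn ..
  also have "\<dots> = (\<Sum>B\<in>UNIV. ?s B (sym_diff B C) * ?s B B * ?s (sym_diff B C) (sym_diff B C) *
      (cl_coeff a (sym_diff B C) * cl_coeff b B))"
    by (rule sum.reindex_bij_witness[where i = "\<lambda>A. sym_diff A C" and j = "\<lambda>A. sym_diff A C"])
       (simp_all only: 1 UNIV_I)
  also have "\<dots> = cl_coeff (cl_conj b * cl_conj a) C"
    by (simp add: cl_coeff_conj cl_coeff_mult mult_ac)
  finally show "cl_coeff (cl_conj (a * b)) C = cl_coeff (cl_conj b * cl_conj a) C" .
qed

text \<open>
  Points of \<open>\<real>\<^sup>n\<^sup>+\<^sup>1\<close> are written in coordinates \<open>x :: real ^ 'n option\<close>, where \<open>x $ None\<close> is \<open>x\<^sub>0\<close> and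
  \<open>x $ Some i\<close> is \<open>x\<^sub>i\<close>; \<open>paravector\<close> is the identification with \<open>\<real> \<oplus> \<real>\<^sup>n \<subset> Cl\<^sub>n\<close>.
\<close>
definition paravector :: "real ^ 'n option \<Rightarrow> 'n::{finite,linorder} clifford"
  where "paravector x = (x $ None) *\<^sub>R 1 + (\<Sum>i\<in>UNIV. (x $ Some i) *\<^sub>R cl_e i)"

definition paravectors :: "'n::{finite,linorder} clifford set"
  where "paravectors = range paravector"

definition vectors :: "'n::{finite,linorder} clifford set"
  where "vectors = span (range cl_e)"

definition bivectors :: "'n::{finite,linorder} clifford set"
  where "bivectors = span {cl_e i * cl_e j | i j. i < j}"

definition Spin_group :: "'n::{finite,linorder} clifford set"
  where "Spin_group = {prod_list as | as k.
    length as = 2 * k \<and> (\<forall>a\<in>set as. a \<in> paravectors \<and> norm a = 1)}"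

lemma norm_paravector: "norm (paravector x) = norm x"
proof -
  have eq: "inner 1 (cl_e i) = 0" "inner (cl_e i) 1 = 0"
      "inner (cl_e i) (cl_e j) = (if i = j then 1 else 0)" "inner 1 (1 :: 'a clifford) = 1"
    for i j :: 'a
    unfolding cl_e_def one_clifford_def
    by (simp_all add: inner_Basis Basis_clifford_def)
  have "(norm (paravector x))\<^sup>2 = (x $ None)\<^sup>2 + (\<Sum>i\<in>UNIV. (x $ Some i)\<^sup>2)"
    unfolding paravector_def power2_norm_eq_inner
    by (simp add: inner_add_left inner_add_right inner_sum_left inner_sum_right eq
        power2_eq_square if_distrib cong: if_cong)
  also have "\<dots> = (norm x)\<^sup>2"
    by (simp add: norm_vec_def L2_set_def UNIV_option_conv sum.reindex sum_nonneg)
  finally show ?thesis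
    by simp
qed

subsection \<open>Functions of a paravector variable\<close>

text \<open>The index \<open>None\<close> stands for \<open>\<partial>/\<partial>x\<^sub>0\<close>, the index \<open>Some k\<close> for \<open>\<partial>/\<partial>x\<^sub>k\<close>.\<close>
definition partial :: "'n option \<Rightarrow> (real ^ 'n option \<Rightarrow> 'n::{finite,linorder} clifford) \<Rightarrow>
    real ^ 'n option \<Rightarrow> 'n clifford"
  where "partial i f z = vector_derivative (\<lambda>t. f (z + t *\<^sub>R axis i 1)) (at 0)"

definition continuously_differentiable_on ::
    "'a set \<Rightarrow> ('a::real_normed_vector \<Rightarrow> 'b::real_normed_vector) \<Rightarrow> bool"
  where "continuously_differentiable_on D g \<longleftrightarrow>
    (\<exists>g' :: 'a \<Rightarrow> 'a \<Rightarrow>\<^sub>L 'b. (\<forall>z\<in>D. (g has_derivative blinfun_apply (g' z)) (at z)) \<and>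
      continuous_on D g')"

definition C1_on :: "(real ^ 'n option) set \<Rightarrow>
    (real ^ 'n option \<Rightarrow> 'n::{finite,linorder} clifford) \<Rightarrow> bool"
  where "C1_on D f \<longleftrightarrow> (\<forall>A. continuously_differentiable_on D (\<lambda>z. cl_coeff (f z) A))"

definition gauss_conformal :: "(real ^ 'n option) set \<Rightarrow>
    (real ^ 'n option \<Rightarrow> 'n::{finite,linorder} clifford) \<Rightarrow> bool"
  where "gauss_conformal D f \<longleftrightarrow>
    (\<exists>\<mu> :: real ^ 'n option \<Rightarrow> real. (\<forall>z\<in>D. \<mu> z > 0) \<and>
      (\<forall>z\<in>D. \<forall>v :: real ^ 'n option.
        (norm (\<Sum>i\<in>UNIV. (v $ i) *\<^sub>R partial i f z))\<^sup>2 = \<mu> z * (\<Sum>i\<in>UNIV. (v $ i)\<^sup>2)))"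

end

theory Submission imports Defs begin

text \<open>
  Every element satisfies \<open>Sc (a * cl_conj b) = \<langle>a, b\<rangle>\<close>, and a paravector \<open>p\<close> satisfies
  \<open>p * cl_conj p = cl_conj p * p = |p|\<^sup>2\<close>. Hence right multiplication by a paravector \<open>p\<close> scales inner
  products by \<open>|p|\<^sup>2\<close>, and a nonzero paravector has the inverse \<open>cl_conj p / |p|\<^sup>2\<close>.

  By polarisation, conformality at a point says that the \<open>n + 1\<close> partial derivatives are pairwise
  orthogonal and of equal length. If \<open>p\<close> denotes \<open>\<partial>f/\<partial>x\<^sub>0\<close>, the equations \<open>\<partial>f/\<partial>x\<^sub>k = \<Psi>\<^sub>k p\<close> force
  \<open>\<Psi>\<^sub>k = \<partial>f/\<partial>x\<^sub>k * cl_conj p / |p|\<^sup>2\<close>, and dividing the inner products of the partial derivatives by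
  \<open>|p|\<^sup>2\<close> gives exactly \<open>Sc \<Psi>\<^sub>k\<close> and \<open>Sc (\<Psi>\<^sub>i * cl_conj \<Psi>\<^sub>j)\<close>. So the orthogonality relations of the
  partial derivatives are equivalent to the conditions on the scalar parts.

  The remaining properties of \<open>\<Psi>\<^sub>k\<close> follow from its formula: it is a product of two paravectors, so it
  has no part of degree above two, and its scalar part vanishes; the equal lengths of the partial
  derivatives make it a product of two unit paravectors; and it is continuous because \<open>f\<close> is \<open>C\<^sup>1\<close>.
\<close>

section \<open>Products of paravectors\<close>

lemma inner_clifford_eq_sum: "inner a b = (\<Sum>A\<in>UNIV. cl_coeff a A * cl_coeff b A)"
  by (simp add: inner_clifford_def inner_vec_def cl_coeff_def)

text \<open>
  Conjugation multiplies the coefficient of \<open>e\<^sub>A\<close> by the sign of \<open>e\<^sub>A * e\<^sub>A\<close>, so both signs cancel in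
  the coefficient of \<open>1\<close>.
\<close>
lemma Sc_mult_conj: "Sc (a * cl_conj b) = inner a b"
proof -
  have cancel: "blade_sign A A * cl_coeff a A * (blade_sign A A * cl_coeff b A)
      = cl_coeff a A * cl_coeff b A" for A
    using blade_sign_square[of A A] by algebra
  show ?thesis
    by (simp add: Sc_def cl_coeff_mult cl_coeff_conj inner_clifford_eq_sum cancel)
qed

lemma cl_conj_conj: "cl_conj (cl_conj a) = a"
  by (rule clifford_eqI) (simp add: cl_coeff_conj flip: mult.assoc)

lemma cl_conj_one: "cl_conj 1 = 1"
  by (rule clifford_eqI) (simp add: cl_coeff_conj cl_coeff_one)

lemma norm_cl_conj: "norm (cl_conj a) = norm a"
  by (simp add: norm_clifford_eq cl_coeff_conj power2_eq_square mult.left_commute flip: mult.assoc)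

lemma Sc_scaleR: "Sc (r *\<^sub>R a) = r * Sc a"
  by (simp add: Sc_def)

lemma linear_paravector: "linear paravector"
  by (rule linearI)
     (simp_all add: paravector_def algebra_simps sum.distrib scaleR_sum_right)

lemma subspace_paravectors: "subspace paravectors"
  unfolding paravectors_def by (rule linear_subspace_image[OF linear_paravector subspace_UNIV])

lemma cl_conj_paravector_mem:
  assumes "p \<in> paravectors"
  shows "cl_conj p \<in> paravectors"
proof -
  obtain x where p: "p = paravector x"
    using assms by (auto simp: paravectors_def)
  have "cl_conj p = paravector (\<chi> i. case i of None \<Rightarrow> x $ None | Some k \<Rightarrow> - (x $ Some k))"
    unfolding p paravector_def
    by (simp add: linear_add[OF linear_cl_conj] linear_sum[OF linear_cl_conj]
        linear_scale[OF linear_cl_conj] cl_conj_one cl_conj_e sum_negf)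
  then show ?thesis
    by (simp add: paravectors_def)
qed

lemma paravectors_subset_span:
  "(paravectors :: 'n::{finite,linorder} clifford set) \<subseteq> span (insert 1 (range cl_e))"
proof
  fix p :: "'n clifford"
  assume "p \<in> paravectors"
  then show "p \<in> span (insert 1 (range cl_e))"
    unfolding paravectors_def paravector_def
    by (auto intro!: span_add span_scale span_sum intro: span_base)
qed

lemma mult_mem_span:
  fixes a b :: "'a::real_algebra"
  assumes "a \<in> span S" and "b \<in> span S"
    and gen: "\<And>x y. x \<in> S \<Longrightarrow> y \<in> S \<Longrightarrow> x * y \<in> span T"
  shows "a * b \<in> span T"
  using assms(1)
proof (induction rule: span_induct_alt)
  case base
  show ?case by (simp add: span_zero)
next
  case (step c x y)
  have "x * b \<in> span T"
    using assms(2)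
  proof (induction rule: span_induct_alt)
    case base
    show ?case by (simp add: span_zero)
  next
    case (step d u w)
    then show ?case
      using gen[OF \<open>x \<in> S\<close>] by (simp add: distrib_left span_add span_scale)
  qed
  then show ?case
    using step by (simp add: distrib_right span_add span_scale)
qed

text \<open>
  Each product of two elements of \<open>{1, e\<^sub>1, \<dots>, e\<^sub>n}\<close> has degree at most two, because
  \<open>e\<^sub>i * e\<^sub>i = - 1\<close> and \<open>e\<^sub>i * e\<^sub>j = - e\<^sub>j * e\<^sub>i\<close> for \<open>i > j\<close>.
\<close>
lemma mult_paravectors_decompose:
  fixes p q :: "'n::{finite,linorder} clifford"
  assumes "p \<in> paravectors" and "q \<in> paravectors"
  obtains r u w where "p * q = r *\<^sub>R 1 + u + w" and "u \<in> vectors" and "w \<in> bivectors"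
proof -
  let ?B = "{cl_e i * cl_e j | i j :: 'n. i < j}"
  let ?T = "insert 1 (range cl_e \<union> ?B)"
  have e: "cl_e i * cl_e j \<in> span ?T" for i j :: 'n
  proof (cases i j rule: linorder_cases)
    case less
    then show ?thesis by (intro span_base) auto
  next
    case equal
    then show ?thesis by (simp add: cl_e_square span_neg span_base)
  next
    case greater
    then have "cl_e i * cl_e j = - (cl_e j * cl_e i)"
      by (intro cl_e_anticommute) simp
    with greater show ?thesis
      by (auto intro!: span_neg[OF span_base])
  qed
  have "p * q \<in> span ?T"
  proof (rule mult_mem_span)
    show "p \<in> span (insert 1 (range cl_e))" "q \<in> span (insert 1 (range cl_e))"
      using assms paravectors_subset_span by auto
    show "x * y \<in> span ?T"
      if "x \<in> insert 1 (range cl_e)" "y \<in> insert 1 (range cl_e)" for x y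
      using that e by (auto intro: span_base)
  qed
  then obtain r where "p * q - r *\<^sub>R 1 \<in> span (range cl_e \<union> ?B)"
    by (auto simp: span_insert)
  then obtain u w where "p * q - r *\<^sub>R 1 = u + w" "u \<in> vectors" "w \<in> bivectors"
    by (auto simp: span_Un vectors_def bivectors_def)
  then show thesis
    by (intro that[of r u w]) (simp_all add: algebra_simps)
qed

lemma cl_conj_vector: "cl_conj u = - u" if "u \<in> vectors"
  using that unfolding vectors_def
proof (induction rule: span_induct_alt)
  case (step c x y)
  then show ?case
    by (auto simp: linear_add[OF linear_cl_conj] linear_scale[OF linear_cl_conj] cl_conj_e)
qed (simp add: linear_0[OF linear_cl_conj])

lemma cl_conj_bivector: "cl_conj w = - w" if "w \<in> bivectors"
  using that unfolding bivectors_def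
proof (induction rule: span_induct_alt)
  case (step c x y)
  then obtain i j :: 'a where "x = cl_e i * cl_e j" "i < j"
    by auto
  then have "cl_conj x = - x"
    by (simp add: cl_conj_mult cl_conj_e cl_e_anticommute[of j i])
  with step show ?case
    by (simp add: linear_add[OF linear_cl_conj] linear_scale[OF linear_cl_conj])
qed (simp add: linear_0[OF linear_cl_conj])

lemma Sc_one: "Sc 1 = 1"
  by (simp add: Sc_def cl_coeff_one)

lemma Sc_add: "Sc (a + b) = Sc a + Sc b"
  by (simp add: Sc_def)

lemma Sc_cl_conj: "Sc (cl_conj a) = Sc a"
  by (simp add: Sc_def cl_coeff_conj)

lemma Sc_eq_zero_if_conj_neg: "Sc a = 0" if "cl_conj a = - a"
  using that Sc_cl_conj[of a] by (simp add: Sc_def)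

text \<open>
  The product is its own conjugate, while conjugation negates its vector and bivector parts; so
  only the scalar part, which is the squared norm, survives.
\<close>
lemma paravector_mult_conj:
  assumes "p \<in> paravectors"
  shows "p * cl_conj p = (norm p)\<^sup>2 *\<^sub>R 1"
proof -
  obtain r u w where eq: "p * cl_conj p = r *\<^sub>R 1 + u + w"
    and "u \<in> vectors" "w \<in> bivectors"
    using mult_paravectors_decompose[OF assms cl_conj_paravector_mem[OF assms]] .
  then have "cl_conj (p * cl_conj p) = r *\<^sub>R 1 - u - w"
    by (simp add: linear_add[OF linear_cl_conj] linear_scale[OF linear_cl_conj]
        cl_conj_one cl_conj_vector cl_conj_bivector)
  moreover have "cl_conj (p * cl_conj p) = p * cl_conj p"
    by (simp add: cl_conj_mult cl_conj_conj)
  ultimately have "(u + w) + (u + w) = 0"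
    using eq by (simp add: algebra_simps)
  then have "2 *\<^sub>R (u + w) = 0"
    by (simp only: scaleR_2)
  then have scalar: "p * cl_conj p = r *\<^sub>R 1"
    using eq by (simp add: add.assoc)
  have "r = Sc (p * cl_conj p)"
    unfolding scalar by (simp add: Sc_scaleR Sc_one)
  then have "r = (norm p)\<^sup>2"
    by (simp add: Sc_mult_conj power2_norm_eq_inner)
  with scalar show ?thesis
    by simp
qed

lemma paravector_conj_mult:
  assumes "p \<in> paravectors"
  shows "cl_conj p * p = (norm p)\<^sup>2 *\<^sub>R 1"
  using paravector_mult_conj[OF cl_conj_paravector_mem[OF assms]]
  unfolding cl_conj_conj norm_cl_conj .

lemma inner_mult_paravector:
  assumes "p \<in> paravectors"
  shows "inner (a * p) (b * p) = (norm p)\<^sup>2 * inner a b"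
proof -
  have "inner (a * p) (b * p) = Sc (a * (p * cl_conj p) * cl_conj b)"
    by (simp add: cl_conj_mult mult.assoc flip: Sc_mult_conj)
  also have "\<dots> = (norm p)\<^sup>2 * inner a b"
    by (simp add: paravector_mult_conj[OF assms] Sc_scaleR Sc_mult_conj)
  finally show ?thesis .
qed

lemma mult_unit_paravectors_Spin:
  assumes "p \<in> paravectors" "norm p = 1" "q \<in> paravectors" "norm q = 1"
  shows "p * q \<in> Spin_group"
proof -
  have "p * q = prod_list [p, q]" "length [p, q] = 2 * 1" "\<forall>a\<in>set [p, q]. a \<in> paravectors \<and> norm a = 1"
    using assms by auto
  then show ?thesis
    unfolding Spin_group_def by blast
qed

lemma continuous_on_clifford_mult:
  fixes g h :: "'a::topological_space \<Rightarrow> 'n::{finite,linorder} clifford"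
  assumes "continuous_on S g" "continuous_on S h"
  shows "continuous_on S (\<lambda>z. g z * h z)"
proof -
  have "bilinear (\<lambda>a b :: 'n clifford. a * b)"
    by (auto simp: bilinear_def algebra_simps intro!: linearI)
  then have "bounded_bilinear (\<lambda>a b :: 'n clifford. a * b)"
    by (simp only: bilinear_conv_bounded_bilinear)
  then show ?thesis
    using assms by (rule bounded_bilinear.continuous_on)
qed

section \<open>Partial derivatives\<close>

text \<open>
  Differentiability is given coefficient by coefficient; the expansion in the basis \<open>e\<^sub>A\<close> assembles
  the derivatives of the coefficients into one of the Clifford-valued function.
\<close>
lemma C1_on_has_derivative:
  fixes f :: "real ^ 'n::{finite,linorder} option \<Rightarrow> 'n clifford"
  assumes "C1_on D f"
  obtains f' :: "real ^ 'n option \<Rightarrow> real ^ 'n option \<Rightarrow> 'n clifford"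
  where "\<And>z. z \<in> D \<Longrightarrow> (f has_derivative f' z) (at z)"
    and "\<And>v. continuous_on D (\<lambda>z. f' z v)"
proof -
  have "\<forall>A. \<exists>g' :: real ^ 'n option \<Rightarrow> (real ^ 'n option) \<Rightarrow>\<^sub>L real.
      (\<forall>z\<in>D. ((\<lambda>z. cl_coeff (f z) A) has_derivative blinfun_apply (g' z)) (at z)) \<and>
      continuous_on D g'"
    using assms unfolding C1_on_def continuously_differentiable_on_def by blast
  then obtain g' :: "'n set \<Rightarrow> real ^ 'n option \<Rightarrow> (real ^ 'n option) \<Rightarrow>\<^sub>L real"
    where der: "\<And>A z. z \<in> D \<Longrightarrow>
        ((\<lambda>z. cl_coeff (f z) A) has_derivative blinfun_apply (g' A z)) (at z)"
      and cont: "\<And>A. continuous_on D (g' A)"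
    by metis
  show thesis
  proof (rule that[of "\<lambda>z v. \<Sum>A\<in>UNIV. g' A z v *\<^sub>R blade A"])
    fix z assume "z \<in> D"
    have "((\<lambda>z. \<Sum>A\<in>UNIV. cl_coeff (f z) A *\<^sub>R blade A) has_derivative
        (\<lambda>v. \<Sum>A\<in>UNIV. g' A z v *\<^sub>R blade A)) (at z)"
      by (intro has_derivative_sum has_derivative_scaleR_left der \<open>z \<in> D\<close>)
    then show "(f has_derivative (\<lambda>v. \<Sum>A\<in>UNIV. g' A z v *\<^sub>R blade A)) (at z)"
      by (simp flip: clifford_expansion)
  next
    fix v
    show "continuous_on D (\<lambda>z. \<Sum>A\<in>UNIV. g' A z v *\<^sub>R blade A)"
      by (intro continuous_intros cont)
  qed
qed

lemma has_vector_derivative_along_line: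
  assumes "(f has_derivative f') (at z)"
  shows "((\<lambda>t. f (z + t *\<^sub>R v)) has_vector_derivative f' v) (at 0)"
proof -
  have "((\<lambda>t. z + t *\<^sub>R v) has_derivative (\<lambda>t. t *\<^sub>R v)) (at 0)"
    by (auto intro!: derivative_eq_intros)
  moreover have "(f has_derivative f') (at (z + 0 *\<^sub>R v))"
    using assms by simp
  ultimately have "((\<lambda>t. f (z + t *\<^sub>R v)) has_derivative (\<lambda>t. f' (t *\<^sub>R v))) (at 0)"
    by (rule has_derivative_compose)
  moreover have "f' (t *\<^sub>R v) = t *\<^sub>R f' v" for t
    using assms by (rule linear_scale[OF has_derivative_linear])
  ultimately show ?thesis
    by (simp add: has_vector_derivative_def)
qed

text \<open>A derivative along a line is a limit of difference quotients, and a subspace is closed.\<close>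
lemma has_vector_derivative_in_subspace:
  fixes g :: "real \<Rightarrow> 'a::euclidean_space"
  assumes "(g has_vector_derivative g') (at t)"
    and "subspace S" and "eventually (\<lambda>s. g s \<in> S) (nhds t)"
  shows "g' \<in> S"
proof (rule Lim_in_closed_set)
  show "closed S"
    using assms(2) by (rule closed_subspace)
  have "g t \<in> S"
    using assms(3) by (rule eventually_nhds_x_imp_x)
  then show "eventually (\<lambda>s. (g s - g t) /\<^sub>R (s - t) \<in> S) (at t)"
    using assms(2,3) unfolding eventually_at_filter
    by (auto elim!: eventually_mono intro!: subspace_scale subspace_diff)
  have "((\<lambda>s. (g s - g t - (s - t) *\<^sub>R g') /\<^sub>R \<bar>s - t\<bar>) \<longlongrightarrow> 0) (at t)"
    using assms(1) by (simp add: has_vector_derivative_def has_derivative_at_within)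
  then have "((\<lambda>s. norm ((g s - g t - (s - t) *\<^sub>R g') /\<^sub>R \<bar>s - t\<bar>)) \<longlongrightarrow> 0) (at t)"
    by (rule tendsto_norm_zero)
  moreover have "norm ((g s - g t - (s - t) *\<^sub>R g') /\<^sub>R \<bar>s - t\<bar>)
      = norm ((g s - g t) /\<^sub>R (s - t) - g')" if "s \<noteq> t" for s
  proof -
    have "(g s - g t) /\<^sub>R (s - t) - g' = (g s - g t - (s - t) *\<^sub>R g') /\<^sub>R (s - t)"
      using that by (simp add: scaleR_diff_right)
    then show ?thesis
      by simp
  qed
  then have "eventually (\<lambda>s. norm ((g s - g t - (s - t) *\<^sub>R g') /\<^sub>R \<bar>s - t\<bar>)
      = norm ((g s - g t) /\<^sub>R (s - t) - g')) (at t)"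
    by (simp add: eventually_at_filter)
  ultimately have "((\<lambda>s. norm ((g s - g t) /\<^sub>R (s - t) - g')) \<longlongrightarrow> 0) (at t)"
    by (rule Lim_transform_eventually)
  then show "((\<lambda>s. (g s - g t) /\<^sub>R (s - t)) \<longlongrightarrow> g') (at t)"
    by (rule LIM_zero_cancel[OF tendsto_norm_zero_cancel])
qed simp

lemma partial_in_paravectors:
  fixes f :: "real ^ 'n::{finite,linorder} option \<Rightarrow> 'n clifford"
  assumes "open D" "z \<in> D" "\<forall>z\<in>D. f z \<in> paravectors" "(f has_derivative f') (at z)"
  shows "partial i f z \<in> paravectors"
proof -
  let ?l = "\<lambda>t. z + t *\<^sub>R axis i 1"
  have der: "((\<lambda>t. f (?l t)) has_vector_derivative f' (axis i 1)) (at 0)"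
    using assms(4) by (rule has_vector_derivative_along_line)
  have "open (?l -` D)"
    using assms(1) by (intro open_vimage continuous_intros)
  then have "eventually (\<lambda>t. t \<in> ?l -` D) (nhds 0)"
    using assms(2) by (intro eventually_nhds_in_open) simp_all
  then have "eventually (\<lambda>t. f (?l t) \<in> paravectors) (nhds 0)"
    by (rule eventually_mono) (use assms(3) in auto)
  then have "f' (axis i 1) \<in> paravectors"
    by (rule has_vector_derivative_in_subspace[OF der subspace_paravectors])
  then show ?thesis
    using vector_derivative_at[OF der] by (simp add: partial_def)
qed

lemma continuous_on_partial:
  assumes "C1_on D f"
  shows "continuous_on D (partial i f)"
proof -
  obtain f' where der: "\<And>z. z \<in> D \<Longrightarrow> (f has_derivative f' z) (at z)"
    and cont: "\<And>v. continuous_on D (\<lambda>z. f' z v)"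
    using C1_on_has_derivative[OF assms] by blast
  have "partial i f z = f' z (axis i 1)" if "z \<in> D" for z
    unfolding partial_def
    by (rule vector_derivative_at[OF has_vector_derivative_along_line[OF der[OF that]]])
  then show ?thesis
    using cont by (simp cong: continuous_on_cong)
qed

section \<open>Conformality as orthogonality of the partial derivatives\<close>

text \<open>Polarisation, using the unit vectors and the sums of two of them.\<close>
lemma norm_sum_scaled_iff_orthogonal:
  fixes p :: "'i::finite \<Rightarrow> 'a::real_inner"
  shows "(\<forall>v :: real ^ 'i. (norm (\<Sum>i\<in>UNIV. (v $ i) *\<^sub>R p i))\<^sup>2 = \<mu> * (\<Sum>i\<in>UNIV. (v $ i)\<^sup>2)) \<longleftrightarrow>
    (\<forall>i j. inner (p i) (p j) = (if i = j then \<mu> else 0))" (is "?L \<longleftrightarrow> ?R")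
proof
  assume L: ?L
  define S where "S v = (\<Sum>i\<in>UNIV. (v $ i) *\<^sub>R p i)" for v :: "real ^ 'i"
  have norm_S: "(norm (S v))\<^sup>2 = \<mu> * (norm v)\<^sup>2" for v
    using L by (simp add: S_def norm_vec_def L2_set_def sum_nonneg)
  have S_axis: "S (axis i 1) = p i" for i
    by (simp add: S_def axis_def if_distrib if_distribR cong: if_cong)
  have S_add: "S (v + w) = S v + S w" for v w
    by (simp add: S_def scaleR_left_distrib sum.distrib)
  have diag: "inner (p i) (p i) = \<mu>" for i
    using norm_S[of "axis i 1"] by (simp add: S_axis power2_norm_eq_inner inner_axis_axis)
  have "inner (p i) (p j) = 0" if "i \<noteq> j" for i j
  proof -
    have "(norm (p i + p j))\<^sup>2 = \<mu> * (norm (axis i 1 + axis j 1 :: real ^ 'i))\<^sup>2"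
      using norm_S[of "axis i 1 + axis j 1"] by (simp add: S_add S_axis)
    then show ?thesis
      using that
      by (simp add: power2_norm_eq_inner inner_add_left inner_add_right inner_axis_axis diag
          inner_commute[of "p j" "p i"])
  qed
  then show ?R
    using diag by simp
next
  assume ?R
  then have R: "inner (p i) (p j) = (if i = j then \<mu> else 0)" for i j
    by blast
  show ?L
    unfolding power2_norm_eq_inner inner_sum_left inner_sum_right
    by (simp add: R if_distrib power2_eq_square sum_distrib_left mult_ac cong: if_cong)
qed

text \<open>
  The conformal factor can only be the common squared length of the partial derivatives; it is
  positive because \<open>\<partial>f/\<partial>x\<^sub>0\<close> does not vanish.
\<close>
lemma gauss_conformal_iff_orthogonal:
  assumes "\<forall>z\<in>D. partial None f z \<noteq> 0"
  shows "gauss_conformal D f \<longleftrightarrow> (\<forall>z\<in>D. \<forall>i j.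
    inner (partial i f z) (partial j f z) = (if i = j then (norm (partial None f z))\<^sup>2 else 0))"
    (is "_ \<longleftrightarrow> ?R")
proof
  assume "gauss_conformal D f"
  then obtain \<mu> where *: "\<And>z i j. z \<in> D \<Longrightarrow>
      inner (partial i f z) (partial j f z) = (if i = j then \<mu> z else 0)"
    unfolding gauss_conformal_def norm_sum_scaled_iff_orthogonal by blast
  then show ?R
    by (simp add: power2_norm_eq_inner)
next
  assume ?R
  then show "gauss_conformal D f"
    unfolding gauss_conformal_def norm_sum_scaled_iff_orthogonal
    using assms by (intro exI[of _ "\<lambda>z. (norm (partial None f z))\<^sup>2"]) simp
qed

section \<open>The characterisation of conformal functions\<close>

theorem theorem3p7:
  fixes D :: "(real ^ 'n::{finite,linorder} option) set"
    and f :: "real ^ 'n option \<Rightarrow> 'n clifford"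
  assumes "open D" and "connected D" and "D \<noteq> {}"
    and "\<forall>z\<in>D. f z \<in> paravectors"
    and "C1_on D f"
    and "\<forall>z\<in>D. partial None f z \<noteq> 0"
  shows "gauss_conformal D f \<longleftrightarrow>
    (\<exists>\<Psi> :: 'n \<Rightarrow> real ^ 'n option \<Rightarrow> 'n clifford.
      (\<forall>i. continuous_on D (\<Psi> i)) \<and>
      (\<forall>i. \<forall>z\<in>D. \<Psi> i z \<in> {u + w | u w. u \<in> vectors \<and> w \<in> bivectors} \<and>
        \<Psi> i z \<in> Spin_group) \<and>
      (\<forall>z\<in>D.
        (\<forall>i. Sc (\<Psi> i z) = 0) \<and>
        (\<forall>i j. Sc (\<Psi> i z * cl_conj (\<Psi> j z)) = (if i = j then 1 else 0)) \<and>
        (\<forall>k. partial (Some k) f z = \<Psi> k z * partial None f z)))"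
proof
  assume "gauss_conformal D f"
  then have orth: "inner (partial i f z) (partial j f z) =
      (if i = j then (norm (partial None f z))\<^sup>2 else 0)" if "z \<in> D" for z i j
    using that assms(6) by (simp add: gauss_conformal_iff_orthogonal)
  have para: "partial i f z \<in> paravectors" if "z \<in> D" for i z
    using C1_on_has_derivative[OF assms(5)] partial_in_paravectors[OF assms(1) that assms(4)]
      that by metis
  define \<Psi> where
    "\<Psi> k z = (partial (Some k) f z * cl_conj (partial None f z)) /\<^sub>R (norm (partial None f z))\<^sup>2"
    for k z
  have nonzero: "norm (partial None f z) \<noteq> 0" if "z \<in> D" for z
    using assms(6) that by simp
  have norm_eq: "norm (partial i f z) = norm (partial None f z)" if "z \<in> D" for i z
    using orth[OF that, of i i] by (simp add: norm_eq_sqrt_inner)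
  have Sc_\<Psi>: "Sc (\<Psi> k z) = 0" if "z \<in> D" for k z
    using orth[OF that] by (simp add: \<Psi>_def Sc_scaleR Sc_mult_conj)
  have deriv: "partial (Some k) f z = \<Psi> k z * partial None f z" if "z \<in> D" for k z
    using nonzero[OF that] by (simp add: \<Psi>_def mult.assoc paravector_conj_mult[OF para[OF that]])
  have ortho: "Sc (\<Psi> i z * cl_conj (\<Psi> j z)) = (if i = j then 1 else 0)" if "z \<in> D" for i j z
  proof -
    have "(norm (partial None f z))\<^sup>2 * inner (\<Psi> i z) (\<Psi> j z)
        = inner (partial (Some i) f z) (partial (Some j) f z)"
      using inner_mult_paravector[OF para[OF that]] deriv[OF that] by metis
    then show ?thesis
      using orth[OF that] nonzero[OF that] by (simp add: Sc_mult_conj split: if_splits)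
  qed
  have cont: "continuous_on D (\<Psi> k)" for k
    unfolding \<Psi>_def
    by (intro continuous_intros continuous_on_clifford_mult continuous_on_partial assms(5)
        linear_continuous_on_compose[OF _ linear_cl_conj])
       (use nonzero in auto)
  have spin: "\<Psi> k z \<in> Spin_group" if "z \<in> D" for k z
  proof -
    \<comment> \<open>The factor \<open>|p|\<^sup>-\<^sup>2\<close> is shared out evenly: both \<open>\<partial>f/\<partial>x\<^sub>k\<close> and \<open>cl_conj p\<close> have length \<open>|p|\<close>.\<close>
    let ?c = "inverse (norm (partial None f z))"
    have "\<Psi> k z = (?c *\<^sub>R partial (Some k) f z) * (?c *\<^sub>R cl_conj (partial None f z))"
      by (simp add: \<Psi>_def power2_eq_square)
    moreover have "norm (?c *\<^sub>R partial (Some k) f z) = 1"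
        "norm (?c *\<^sub>R cl_conj (partial None f z)) = 1"
      using nonzero[OF that] norm_eq[OF that, of "Some k"] by (simp_all add: norm_cl_conj)
    ultimately show ?thesis
      using para[OF that]
      by (simp add: mult_unit_paravectors_Spin cl_conj_paravector_mem
          subspace_scale[OF subspace_paravectors] del: scaleR_scaleR mult_scaleR_left mult_scaleR_right)
  qed
  have grade: "\<Psi> k z \<in> {u + w | u w. u \<in> vectors \<and> w \<in> bivectors}" if z: "z \<in> D" for k z
  proof -
    have "inverse ((norm (partial None f z))\<^sup>2) *\<^sub>R partial (Some k) f z \<in> paravectors"
      using para[OF z] subspace_scale[OF subspace_paravectors] by blast
    then obtain r u w where eq: "\<Psi> k z = r *\<^sub>R 1 + u + w" and uw: "u \<in> vectors" "w \<in> bivectors"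
      using mult_paravectors_decompose[OF _ cl_conj_paravector_mem[OF para[OF z]]]
      unfolding \<Psi>_def by (metis mult_scaleR_left)
    have "r = 0"
      using Sc_\<Psi>[OF z, of k] uw unfolding eq
      by (simp add: Sc_add Sc_scaleR Sc_one Sc_eq_zero_if_conj_neg cl_conj_vector cl_conj_bivector)
    with eq uw show ?thesis
      by auto
  qed
  show "\<exists>\<Psi>. (\<forall>i. continuous_on D (\<Psi> i)) \<and>
      (\<forall>i. \<forall>z\<in>D. \<Psi> i z \<in> {u + w | u w. u \<in> vectors \<and> w \<in> bivectors} \<and>
        \<Psi> i z \<in> Spin_group) \<and>
      (\<forall>z\<in>D.
        (\<forall>i. Sc (\<Psi> i z) = 0) \<and>
        (\<forall>i j. Sc (\<Psi> i z * cl_conj (\<Psi> j z)) = (if i = j then 1 else 0)) \<and>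
        (\<forall>k. partial (Some k) f z = \<Psi> k z * partial None f z))"
    using cont grade spin Sc_\<Psi> ortho deriv by (intro exI[of _ \<Psi>]) blast
next
  assume "\<exists>\<Psi>. (\<forall>i. continuous_on D (\<Psi> i)) \<and>
      (\<forall>i. \<forall>z\<in>D. \<Psi> i z \<in> {u + w | u w. u \<in> vectors \<and> w \<in> bivectors} \<and>
        \<Psi> i z \<in> Spin_group) \<and>
      (\<forall>z\<in>D.
        (\<forall>i. Sc (\<Psi> i z) = 0) \<and>
        (\<forall>i j. Sc (\<Psi> i z * cl_conj (\<Psi> j z)) = (if i = j then 1 else 0)) \<and>
        (\<forall>k. partial (Some k) f z = \<Psi> k z * partial None f z))"
  then obtain \<Psi> where Sc_\<Psi>: "\<And>i z. z \<in> D \<Longrightarrow> Sc (\<Psi> i z) = 0"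
    and ortho: "\<And>i j z. z \<in> D \<Longrightarrow> Sc (\<Psi> i z * cl_conj (\<Psi> j z)) = (if i = j then 1 else 0)"
    and deriv: "\<And>k z. z \<in> D \<Longrightarrow> partial (Some k) f z = \<Psi> k z * partial None f z"
    by blast
  have "inner (partial i f z) (partial j f z) = (if i = j then (norm (partial None f z))\<^sup>2 else 0)"
    if z: "z \<in> D" for i j z
  proof -
    let ?p = "partial None f z"
    have p: "?p \<in> paravectors"
      using C1_on_has_derivative[OF assms(5)] partial_in_paravectors[OF assms(1) z assms(4)] z
      by metis
    \<comment> \<open>With \<open>\<Psi>\<^sub>0 = 1\<close> all partial derivatives have the form \<open>\<Psi>\<^sub>i * p\<close>, and the conditions on the
      scalar parts say that the family \<open>\<Psi>\<^sub>0, \<dots>, \<Psi>\<^sub>n\<close> is orthonormal.\<close>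
    define \<Phi> where "\<Phi> i = (case i of None \<Rightarrow> 1 | Some k \<Rightarrow> \<Psi> k z)" for i
    have eq: "partial i f z = \<Phi> i * ?p" for i
      using deriv[OF z] by (simp add: \<Phi>_def split: option.split)
    have one: "inner (\<Psi> k z) 1 = 0" "inner 1 (\<Psi> k z) = 0" "inner 1 (1 :: 'n clifford) = 1" for k
      using Sc_\<Psi>[OF z, of k] Sc_mult_conj[of "\<Psi> k z" 1] Sc_mult_conj[of "1 :: 'n clifford" 1]
      by (simp_all add: cl_conj_one Sc_one inner_commute[of 1 "\<Psi> k z"])
    have "inner (\<Psi> k z) (\<Psi> l z) = (if k = l then 1 else 0)" for k l
      using ortho[OF z, of k l] by (simp only: Sc_mult_conj)
    with one have "inner (\<Phi> i) (\<Phi> j) = (if i = j then 1 else 0)"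
      by (simp add: \<Phi>_def split: option.split)
    then show ?thesis
      unfolding eq[of i] eq[of j] inner_mult_paravector[OF p] by simp
  qed
  then show "gauss_conformal D f"
    using assms(6) by (simp add: gauss_conformal_iff_orthogonal)
qed

end
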